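(* Let $P_3(x)=\prod_{k\geq 0}(1-x^{3^k})\in\mathbb{Z}[[x]]$. Then for every positive integer $n$, $H_n(P_3)\equiv (-1)^{n-1}\pmod 3$.
   Context: For a power series $f=\sum_{i\ge0}a_ix^i$, the Hankel determinant $H_n(f)$ ($n\ge1$) is the determinant of the $n\times n$ matrix $(a_{i+j})_{0\le i,j\le n-1}$, and $H_0(f)=1$. *)

theory Defs
  imports
    Jordan_Normal_Form.Determinant
    "HOL-Analysis.Infinite_Products"
    "HOL-Computational_Algebra.Formal_Power_Series"
    "HOL-Number_Theory.Cong"
begin

definition hankel_mat :: "'a fps \<Rightarrow> nat \<Rightarrow> 'a mat" where
  "hankel_mat f n = Matrix.mat n n (\<lambda>(i, j). fps_nth f (i + j))"

definition hankel_det :: "'a::comm_ring_1 fps \<Rightarrow> nat \<Rightarrow> 'a" where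
  "hankel_det f n = Determinant.det (hankel_mat f n)"

lemma hankel_det_0: "hankel_det f 0 = 1"
  by (simp add: hankel_det_def hankel_mat_def)

text \<open>The infinite product is taken in the library topology on formal power series,
  in which convergence means that every coefficient is eventually constant.\<close>

definition P3 :: "int fps" where
  "P3 = prodinf (\<lambda>k. 1 - fps_X ^ (3 ^ k))"

text \<open>\<^const>\<open>prodinf\<close> is a definite description, so convergence has to be known
  for \<^const>\<open>P3\<close> to denote the intended series.\<close>

lemma P3_has_prod: "(\<lambda>k. 1 - fps_X ^ (3 ^ k)) has_prod P3"
proof -
  let ?f = "\<lambda>k. 1 - fps_X ^ (3 ^ k) :: int fps"
  let ?p = "\<lambda>n. \<Prod>k\<le>n. ?f k"
  have step_eq: "fps_nth (?p (Suc n)) m = fps_nth (?p n) m" if "m \<le> n" for m n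
  proof -
    have "n < 3 ^ n" for n :: nat by (induction n) auto
    from this[of "Suc n"] have "m < 3 ^ Suc n" using that by linarith
    moreover have "?p (Suc n) = ?p n - ?p n * fps_X ^ (3 ^ Suc n)"
      by (simp only: prod.atMost_Suc right_diff_distrib mult_1_right)
    ultimately show ?thesis by (simp only: fps_sub_nth fps_X_power_mult_right_nth if_True diff_zero)
  qed
  have stable: "fps_nth (?p n) m = fps_nth (?p m) m" if "m \<le> n" for m n
    using that
  proof (induction n rule: dec_induct)
    case base
    show ?case ..
  next
    case (step n)
    show ?case by (rule trans[OF step_eq[OF step.hyps(1)] step.IH])
  qed
  define P where "P = Abs_fps (\<lambda>m. fps_nth (?p m) m)"
  have "?p \<longlonglongrightarrow> P"
  proof (rule tendsto_fpsI)
    fix m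
    have "fps_nth (?p n) m = fps_nth P m" if "n \<ge> m" for n
      unfolding P_def fps_nth_Abs_fps using that by (rule stable)
    thus "eventually (\<lambda>n. fps_nth (?p n) m = fps_nth P m) sequentially"
      unfolding eventually_sequentially by blast
  qed
  moreover have "fps_nth P 0 = 1" by (simp add: P_def)
  hence "P \<noteq> 0" by auto
  ultimately have "?f has_prod P" by (simp add: has_prod_def raw_has_prod_def)
  thus ?thesis unfolding P3_def using has_prod_unique by metis
qed

end

theory Submission
  imports Defs "HOL-Computational_Algebra.Formal_Laurent_Series"
begin

text \<open>
  Modulo 3, the functional equation \<open>P(x) = (1 - x) P(x\<^sup>3)\<close> and the Frobenius map give
  \<open>P\<^sup>2 = 1 / (1 - x) = 1 / (1 - 4 x)\<close>, so the coefficients of \<open>P\<close> are the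
  central binomial coefficients. At the level of coefficients this is Lucas' congruence.
  Vandermonde's identity, folded about its centre, factors the Hankel matrix of the central
  binomial coefficients into triangular matrices with diagonals \<open>1, 1, 1, \<dots>\<close> and
  \<open>1, 2, 2, \<dots>\<close>, so its determinant is \<open>2 ^ (n - 1)\<close>, and \<open>2\<close> is \<open>-1\<close> modulo 3.
\<close>

section \<open>Lucas' congruence and central binomials modulo 3\<close>

text \<open>Coefficient form of \<open>(1 + x)^(n + p) = (1 + x)^n (1 + x^p)\<close> modulo
  \<open>p\<close>: in Vandermonde's sum only the terms \<open>l = 0\<close> and
  \<open>l = p\<close> survive. The conditional guards against truncated subtraction in
  \<open>k - p\<close>.\<close>

lemma choose_add_prime_cong:
  fixes p n k :: nat
  assumes "prime p"
  shows "[(n + p) choose k = (n choose k) + (if p \<le> k then n choose (k - p) else 0)] (mod p)"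
proof -
  have p: "p > 0"
    using assms prime_gt_0_nat by blast
  let ?t = "\<lambda>l. (if l = 0 then n choose k else 0) + (if l = p then n choose (k - p) else 0)"
  have "[(p choose l) * (n choose (k - l)) = ?t l] (mod p)" for l
  proof -
    consider "l = 0" | "l = p" | "0 < l" "l < p" | "l > p"
      by linarith
    then show ?thesis
    proof cases
      case 3
      then have "p dvd p choose l"
        using assms by (intro dvd_choose_prime) auto
      then show ?thesis
        using 3 by (simp add: cong_0_iff)
    qed (use p in \<open>auto simp: binomial_eq_0\<close>)
  qed
  then have "[(\<Sum>l\<le>k. (p choose l) * (n choose (k - l))) = (\<Sum>l\<le>k. ?t l)] (mod p)"
    by (intro cong_sum)
  moreover have "(\<Sum>l\<le>k. ?t l) = (n choose k) + (if p \<le> k then n choose (k - p) else 0)"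
    by (simp add: sum.distrib)
  ultimately show ?thesis
    by (simp only: vandermonde add.commute[of n p])
qed

text \<open>Raising \<open>a\<close> by one adds \<open>p\<close> to the upper index, so the
  preceding congruence becomes Pascal's rule for \<open>a choose b\<close>. Only the last
  base-\<open>p\<close> digits \<open>r\<close> and \<open>s\<close> are split off; \<open>a\<close>
  and \<open>b\<close> are arbitrary.\<close>

lemma lucas_choose_cong:
  fixes p a b r s :: nat
  assumes "prime p" "r < p" "s < p"
  shows "[(p * a + r) choose (p * b + s) = (a choose b) * (r choose s)] (mod p)"
proof (induction a arbitrary: b)
  case 0
  show ?case
  proof (cases "b = 0")
    case False
    then have "p * 1 \<le> p * b"
      by (intro mult_le_mono2) simp
    then have "r < p * b + s"
      using assms by linarith
    then show ?thesis
      using False by (simp add: binomial_eq_0)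
  qed simp
next
  case (Suc a)
  have step: "[(p * Suc a + r) choose k =
      ((p * a + r) choose k) + (if p \<le> k then (p * a + r) choose (k - p) else 0)] (mod p)" for k
    using choose_add_prime_cong[OF assms(1), of "p * a + r" k] by (simp add: algebra_simps)
  show ?case
  proof (cases b)
    \<comment> \<open>Here the lower index is \<open>s < p\<close>, so the second term of
      \<open>step\<close> is absent.\<close>
    case 0
    then show ?thesis
      using cong_trans[OF step[of s]] Suc.IH[of 0] assms(3) by simp
  next
    case b: (Suc c)
    have "[((p * a + r) choose (p * Suc c + s)) + ((p * a + r) choose (p * c + s)) =
        (a choose Suc c) * (r choose s) + (a choose c) * (r choose s)] (mod p)"
      by (intro cong_add Suc.IH)
    moreover have "[(p * Suc a + r) choose (p * Suc c + s) =
        ((p * a + r) choose (p * Suc c + s)) + ((p * a + r) choose (p * c + s))] (mod p)"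
      using step[of "p * Suc c + s"] by simp
    ultimately have "[(p * Suc a + r) choose (p * Suc c + s) =
        (a choose Suc c) * (r choose s) + (a choose c) * (r choose s)] (mod p)"
      by (rule cong_trans[rotated])
    then show ?thesis
      unfolding b binomial_Suc_Suc by (simp only: add_mult_distrib add.commute)
  qed
qed

text \<open>Doubling a number with last ternary digit 0, 1 or 2 gives last digit 0, 2 or 1, so Lucas
  supplies the factors \<open>0 choose 0 = 1\<close>, \<open>2 choose 1 = 2\<close> and
  \<open>1 choose 2 = 0\<close>.\<close>

lemma central_binomial_cong_3:
  "[(2 * (3 * m)) choose (3 * m) = (2 * m) choose m] (mod 3)"
  "[(2 * (3 * m + 1)) choose (3 * m + 1) = 2 * ((2 * m) choose m)] (mod 3)"
  "[(2 * (3 * m + 2)) choose (3 * m + 2) = 0] (mod 3)"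
proof -
  note lucas = lucas_choose_cong[of 3]
  show "[(2 * (3 * m)) choose (3 * m) = (2 * m) choose m] (mod 3)"
    using lucas[of 0 0 "2 * m" m] by (simp add: mult.left_commute)
  have "2 * (3 * m + 1) = 3 * (2 * m) + 2"
    by simp
  moreover have "[(3 * (2 * m) + 2) choose (3 * m + 1) = 2 * ((2 * m) choose m)] (mod 3)"
    using lucas[of 2 1 "2 * m" m] by (simp only: mult.commute[of 2 "_ choose _"]) simp
  ultimately show "[(2 * (3 * m + 1)) choose (3 * m + 1) = 2 * ((2 * m) choose m)] (mod 3)"
    by (simp only:)
  have "2 * (3 * m + 2) = 3 * (2 * m + 1) + 1"
    by simp
  moreover have "(1::nat) choose 2 = 0"
    by (simp add: binomial_eq_0)
  ultimately show "[(2 * (3 * m + 2)) choose (3 * m + 2) = 0] (mod 3)"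
    using lucas[of 1 2 "2 * m + 1" m] by (simp only: mult_0_right) simp
qed

section \<open>Coefficients of \<open>P3\<close> modulo 3\<close>

lemma P3_partial_prod_rec:
  "(\<Prod>k<Suc N. 1 - fps_X ^ (3 ^ k)) =
     (1 - fps_X) * ((\<Prod>k<N. 1 - fps_X ^ (3 ^ k)) oo fps_X ^ 3 :: int fps)"
  by (simp add: prod.lessThan_Suc_shift fps_compose_prod_distrib fps_compose_sub_distrib
      fps_X_power_compose power_mult del: prod.lessThan_Suc)

text \<open>If \<open>q\<close> is the product of the first \<open>N\<close> factors, the
  coefficients of \<open>(1 - x) q(x^3)\<close> at \<open>3 d\<close>, \<open>3 d + 1\<close>,
  \<open>3 d + 2\<close> are \<open>q_d\<close>, \<open>- q_d\<close>, \<open>0\<close>. Modulo 3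
  the central binomials obey the same recursion, as \<open>-1\<close> is \<open>2\<close>. The bound
  on \<open>m\<close> is where the finite product still agrees with \<open>P3\<close>.\<close>

lemma P3_partial_prod_nth_cong:
  "m < 3 ^ N \<Longrightarrow>
     [fps_nth (\<Prod>k<N. 1 - fps_X ^ (3 ^ k)) m = int ((2 * m) choose m)] (mod 3)"
proof (induction N arbitrary: m)
  case 0
  then show ?case by simp
next
  case (Suc N)
  let ?q = "\<lambda>N. \<Prod>k<N. 1 - fps_X ^ (3 ^ k) :: int fps"
  define d where "d = m div 3"
  have IH: "[fps_nth (?q N) d = int ((2 * d) choose d)] (mod 3)"
    using Suc.prems by (intro Suc.IH) (simp add: d_def less_mult_imp_div_less mult.commute)
  have nth: "fps_nth (?q (Suc N)) m = fps_nth (?q N oo fps_X ^ 3) m -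
      (if m = 0 then 0 else fps_nth (?q N oo fps_X ^ 3) (m - 1))"
    unfolding P3_partial_prod_rec by (simp add: left_diff_distrib)
  consider "m = 3 * d" | "m = 3 * d + 1" | "m = 3 * d + 2"
    unfolding d_def by linarith
  then show ?case
  proof cases
    case 1
    have "\<not> 3 dvd m - 1" if "m \<noteq> 0"
      using 1 that by presburger
    then have "fps_nth (?q (Suc N)) m = fps_nth (?q N) d"
      unfolding nth using 1 by (auto simp: fps_nth_compose_X_power)
    moreover have "[int ((2 * d) choose d) = int ((2 * m) choose m)] (mod 3)"
      using iffD2[OF cong_int_iff cong_sym[OF central_binomial_cong_3(1)[of d]]]
      by (simp only: of_nat_numeral flip: 1)
    ultimately show ?thesis
      using cong_trans[OF IH] by (simp only:)
  next
    case 2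
    have "\<not> 3 dvd m"
      using 2 by presburger
    then have "fps_nth (?q (Suc N)) m = - fps_nth (?q N) d"
      unfolding nth using 2 by (auto simp: fps_nth_compose_X_power)
    moreover have "[2 * int ((2 * d) choose d) = int ((2 * m) choose m)] (mod 3)"
      using iffD2[OF cong_int_iff cong_sym[OF central_binomial_cong_3(2)[of d]]]
      by (simp only: of_nat_numeral of_nat_mult flip: 2)
    moreover have "[- a = 2 * b] (mod 3)" if "[a = b] (mod 3)" for a b :: int
      using that unfolding cong_def by presburger
    ultimately show ?thesis
      using cong_trans IH by (simp only:) blast
  next
    case 3
    have "\<not> 3 dvd m" "\<not> 3 dvd m - 1"
      using 3 by presburger+
    then have "fps_nth (?q (Suc N)) m = 0"
      unfolding nth using 3 by (auto simp: fps_nth_compose_X_power)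
    moreover have "[0 = int ((2 * m) choose m)] (mod 3)"
      using iffD2[OF cong_int_iff cong_sym[OF central_binomial_cong_3(3)[of d]]]
      by (simp only: of_nat_numeral of_nat_0 flip: 3)
    ultimately show ?thesis
      by (simp only:)
  qed
qed

lemma P3_nth_cong: "[fps_nth P3 m = int ((2 * m) choose m)] (mod 3)"
proof -
  have "(\<lambda>N. \<Prod>k\<le>N. 1 - fps_X ^ (3 ^ k)) \<longlonglongrightarrow> P3"
    using has_prod_imp_tendsto[OF P3_has_prod] .
  then have "eventually (\<lambda>N. fps_nth (\<Prod>k\<le>N. 1 - fps_X ^ (3 ^ k)) m = fps_nth P3 m) sequentially"
    by (simp add: tendsto_fps_iff)
  then obtain N0 where N0: "\<And>N. N \<ge> N0 \<Longrightarrow>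
      fps_nth (\<Prod>k\<le>N. 1 - fps_X ^ (3 ^ k)) m = fps_nth P3 m"
    unfolding eventually_sequentially by blast
  \<comment> \<open>Large enough both for the coefficient to have stabilised and for
    \<open>m < 3 ^ Suc N\<close>.\<close>
  define N where "N = max N0 m"
  have "n < 3 ^ n" for n :: nat
    by (induction n) auto
  from this[of "Suc N"] have "m < 3 ^ Suc N"
    by (simp add: N_def)
  from P3_partial_prod_nth_cong[OF this] N0[of N] show ?thesis
    by (simp add: N_def lessThan_Suc_atMost del: prod.lessThan_Suc)
qed

section \<open>The Hankel determinant of the central binomials\<close>

text \<open>Vandermonde's sum is folded about \<open>l = i\<close>: the terms at
  \<open>i - k\<close> and \<open>i + k\<close> agree, so all but the central one count twice. Terms
  with \<open>k\<close> above \<open>i\<close> or \<open>j\<close> vanish, which allows one range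
  \<open>k < n\<close> for all entries, as a matrix product requires.\<close>

lemma central_binomial_add:
  fixes i j n :: nat
  assumes "i < n" "j < n"
  shows "(2 * (i + j)) choose (i + j) =
    (\<Sum>k<n. (if k = 0 then 1 else 2) * ((2 * i) choose (i + k)) * ((2 * j) choose (j + k)))"
proof -
  obtain m where n: "n = Suc m"
    using assms by (cases n) auto
  define f where "f l = ((2 * i) choose l) * ((2 * j) choose (i + j - l))" for l
  define g where "g k = ((2 * i) choose (i + k)) * ((2 * j) choose (j + k))" for k
  have sym: "(2 * a) choose (a + k) = (2 * a) choose (a - k)" if "k \<le> a" for a k :: nat
    using that binomial_symmetric[of "a + k" "2 * a"] by (simp add: mult_2)
  \<comment> \<open>Below the centre, symmetry is applied to the factor in \<open>2 * i\<close>;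
    above it, in \<open>high\<close>, to the factor in \<open>2 * j\<close>.\<close>
  have low: "(\<Sum>l<i. f l) = (\<Sum>k<m. g (Suc k))"
  proof -
    have "(\<Sum>l<i. f l) = (\<Sum>k<i. f (i - Suc k))"
      by (rule sum.nat_diff_reindex[symmetric])
    also have "\<dots> = (\<Sum>k<i. g (Suc k))"
    proof (intro sum.cong refl)
      fix k assume "k \<in> {..<i}"
      then have "i + j - (i - Suc k) = j + Suc k" "Suc k \<le> i"
        by auto
      then show "f (i - Suc k) = g (Suc k)"
        by (simp only: f_def g_def sym[of "Suc k" i])
    qed
    also have "\<dots> = (\<Sum>k<m. g (Suc k))"
      using assms by (intro sum.mono_neutral_left) (auto simp: g_def n binomial_eq_0)
    finally show ?thesis .
  qed
  have high: "(\<Sum>l=i..i + j. f l) = g 0 + (\<Sum>k<m. g (Suc k))"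
  proof -
    have "(\<Sum>l=i..i + j. f l) = (\<Sum>k\<le>j. f (i + k))"
      using sum.atLeastAtMost_shift_0[of i "i + j" f] by (simp add: atMost_atLeast0)
    also have "\<dots> = (\<Sum>k\<le>j. g k)"
    proof (intro sum.cong refl)
      fix k assume "k \<in> {..j}"
      then show "f (i + k) = g k"
        by (simp add: f_def g_def sym[of k j])
    qed
    also have "\<dots> = (\<Sum>k<n. g k)"
      using assms by (intro sum.mono_neutral_left) (auto simp: g_def binomial_eq_0)
    finally show ?thesis
      unfolding n sum.lessThan_Suc_shift .
  qed
  have "(2 * (i + j)) choose (i + j) = (\<Sum>l\<le>i + j. f l)"
    unfolding f_def vandermonde by (simp add: algebra_simps)
  also have "{..i + j} = {..<i} \<union> {i..i + j}"
    by auto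
  also have "(\<Sum>l\<in>\<dots>. f l) = (\<Sum>l<i. f l) + (\<Sum>l=i..i + j. f l)"
    by (intro sum.union_disjoint) auto
  also have "\<dots> = g 0 + (\<Sum>k<m. 2 * g (Suc k))"
    unfolding low high by (simp add: sum_distrib_left[symmetric])
  finally show ?thesis
    unfolding n sum.lessThan_Suc_shift by (simp add: g_def mult.assoc)
qed

lemma hankel_det_central_binomial:
  assumes "n \<ge> 1"
  shows "hankel_det (Abs_fps (\<lambda>m. of_nat ((2 * m) choose m))) n = (2 ^ (n - 1) :: 'a :: idom)"
proof -
  let ?w = "\<lambda>k::nat. if k = 0 then 1 else 2 :: 'a"
  define L :: "'a mat" where "L = Matrix.mat n n (\<lambda>(i, k). of_nat ((2 * i) choose (i + k)))"
  \<comment> \<open>\<open>U\<close> is the transpose of \<open>L\<close> with row \<open>k\<close>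
    scaled by the folding weight \<open>?w k\<close>.\<close>
  define U :: "'a mat" where
    "U = Matrix.mat n n (\<lambda>(k, j). ?w k * of_nat ((2 * j) choose (j + k)))"
  have carrier: "L \<in> carrier_mat n n" "U \<in> carrier_mat n n"
    by (simp_all add: L_def U_def)
  have "hankel_mat (Abs_fps (\<lambda>m. of_nat ((2 * m) choose m))) n = L * U"
  proof (rule eq_matI)
    fix i j assume "i < dim_row (L * U)" "j < dim_col (L * U)"
    then have ij: "i < n" "j < n"
      by (simp_all add: L_def U_def)
    have "(of_nat ((2 * (i + j)) choose (i + j)) :: 'a) = (\<Sum>k<n.
        of_nat ((2 * i) choose (i + k)) * (?w k * of_nat ((2 * j) choose (j + k))))"
      unfolding central_binomial_add[OF ij] of_nat_sum
      by (intro sum.cong) (auto simp: mult_ac)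
    then show "hankel_mat (Abs_fps (\<lambda>m. of_nat ((2 * m) choose m))) n $$ (i, j) = (L * U) $$ (i, j)"
      using ij by (simp add: hankel_mat_def L_def U_def scalar_prod_def lessThan_atLeast0)
  qed (simp_all add: hankel_mat_def L_def U_def)
  moreover have "det L = 1"
  proof -
    have "det L = prod_list (diag_mat L)"
      by (rule det_lower_triangular[OF _ carrier(1)]) (simp add: L_def binomial_eq_0)
    then show ?thesis
      by (simp add: prod_list_diag_prod L_def flip: mult_2)
  qed
  moreover have "det U = 2 ^ (n - 1)"
  proof -
    obtain m where n: "n = Suc m"
      using assms by (cases n) auto
    have "det U = prod_list (diag_mat U)"
      by (rule det_upper_triangular[OF _ carrier(2)]) (auto simp: U_def binomial_eq_0)
    also have "\<dots> = (\<Prod>k<n. ?w k)"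
      by (simp add: prod_list_diag_prod U_def lessThan_atLeast0 flip: mult_2)
    also have "\<dots> = 2 ^ (n - 1)"
      unfolding n prod.lessThan_Suc_shift by simp
    finally show ?thesis .
  qed
  ultimately show ?thesis
    by (simp add: hankel_det_def det_mult[OF carrier])
qed

section \<open>Reduction of the determinant modulo 3\<close>

text \<open>By the Leibniz expansion the determinant is an integer polynomial in the entries, and
  such polynomials respect congruences.\<close>

lemma hankel_det_cong:
  fixes f g :: "int fps"
  assumes "\<And>m. [fps_nth f m = fps_nth g m] (mod c)"
  shows "[hankel_det f n = hankel_det g n] (mod c)"
proof -
  have "hankel_mat f n \<in> carrier_mat n n" "hankel_mat g n \<in> carrier_mat n n"
    by (simp_all add: hankel_mat_def)
  moreover have "[hankel_mat f n $$ (i, p i) = hankel_mat g n $$ (i, p i)] (mod c)"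
    if "p permutes {0..<n}" "i \<in> {0..<n}" for p i
    using that assms permutes_in_image[OF that(1), of i] by (simp add: hankel_mat_def)
  ultimately show ?thesis
    unfolding hankel_det_def by (simp add: det_def') (intro cong_sum cong_mult cong_prod cong_refl; simp)
qed

theorem theorem1p3:
  fixes n :: nat
  assumes "n \<ge> 1"
  shows "[hankel_det P3 n = (-1) ^ (n - 1)] (mod 3)"
proof -
  have "[hankel_det P3 n = hankel_det (Abs_fps (\<lambda>m. of_nat ((2 * m) choose m))) n] (mod 3)"
    by (intro hankel_det_cong) (simp add: P3_nth_cong)
  then have "[hankel_det P3 n = 2 ^ (n - 1)] (mod 3)"
    unfolding hankel_det_central_binomial[OF assms] .
  moreover have "[2 ^ (n - 1) = (-1) ^ (n - 1)] (mod (3 :: int))"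
    by (intro cong_pow) (simp add: cong_def)
  ultimately show ?thesis
    by (rule cong_trans)
qed

end
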